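(* Let $d\ge2$, $\beta=-\frac12$ and $\gamma>-1$. Let $0\le m\le n$ be integers, let $\{Y_\ell^m:1\le\ell\le\dim\mathcal H_m^d\}$ be an orthonormal basis of $\mathcal H_m^d$, and let $$\mathsf Q_{m,\ell}^n(x,t)=P_{n-m}^{(\beta+m+\frac{d-1}{2},\gamma)}(1-2t)\,t^{\frac m2}\,Y_\ell^m\Big(\frac{x}{\sqrt t}\Big),\qquad (x,t)\in\mathbb V_0^{d+1}.$$ Then $y=\mathsf Q_{m,\ell}^n$, regarded as a function of $(t,\xi)$ with $0<t<1$ and $\xi=x/\sqrt t\in\mathbb S^{d-1}$, satisfies the differential equation $$\left[t(1-t)\partial_t^2+\Big(\tfrac d2-(\gamma+\tfrac d2+1)t\Big)\partial_t+\frac{1-t}{4t}\Delta_0^{(\xi)}\right]y=-\left(n\big(n+\gamma+\tfrac d2\big)-m\big(n+\tfrac{\gamma+d-1}{2}\big)\right)y,$$ where $\Delta_0^{(\xi)}$ is the Laplace–Beltrami operator of $\mathbb S^{d-1}$ acting on the variable $\xi$ and $\partial_t$ is taken with $\xi$ fixed.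
   Context: $\mathbb V_0^{d+1}=\{(x,t):x\in\mathbb R^d,\ \|x\|^2=t,\ 0\le t\le1\}$. $\mathcal H_m^d$ is the space of spherical harmonics of degree $m$ in $d$ variables, i.e. restrictions to the unit sphere $\mathbb S^{d-1}$ of homogeneous harmonic polynomials of degree $m$; orthonormality is with respect to the normalized surface measure on $\mathbb S^{d-1}$. $P_n^{(\alpha,\beta)}$ is the Jacobi polynomial $P_n^{(\alpha,\beta)}(t)=\frac{(\alpha+1)_n}{n!}\,{}_2F_1\big(-n,n+\alpha+\beta+1;\alpha+1;\frac{1-t}{2}\big)$. *)

theory Defs
  imports "HOL-Analysis.Analysis" "HOL-Library.Function_Algebras"
begin

definition partial_deriv :: "'a::euclidean_space \<Rightarrow> ('a \<Rightarrow> real) \<Rightarrow> 'a \<Rightarrow> real" where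
  "partial_deriv b f x = deriv (\<lambda>s. f (x + s *\<^sub>R b)) 0"

definition laplacian :: "('a::euclidean_space \<Rightarrow> real) \<Rightarrow> 'a \<Rightarrow> real" where
  "laplacian f x = (\<Sum>b\<in>Basis. partial_deriv b (partial_deriv b f) x)"

text \<open>
  The Laplace-Beltrami operator of the unit sphere applies the Euclidean Laplacian to the
  extension of \<open>f\<close> that is homogeneous of degree \<open>0\<close>. Only the values of \<open>f\<close> on the
  sphere enter, and \<open>\<xi>\<close> is meant to lie on the sphere.
\<close>

definition laplace_beltrami :: "('a::euclidean_space \<Rightarrow> real) \<Rightarrow> 'a \<Rightarrow> real" where
  "laplace_beltrami f \<xi> = laplacian (\<lambda>x. f (x /\<^sub>R norm x)) \<xi>"

text \<open>
  Normalized surface measure: the image of the uniform distribution on the unit ball under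
  radial projection. As a measure on the whole space it is concentrated on \<open>sphere 0 1\<close>
  (the origin, where the projection takes the value \<open>0\<close>, is a null set).
\<close>

definition sphere_measure :: "'a::euclidean_space measure" where
  "sphere_measure = distr (uniform_measure lborel (ball 0 1)) borel (\<lambda>x. x /\<^sub>R norm x)"

definition sphere_inner :: "('a::euclidean_space \<Rightarrow> real) \<Rightarrow> ('a \<Rightarrow> real) \<Rightarrow> real" where
  "sphere_inner f g = (LINT \<xi>|sphere_measure. f \<xi> * g \<xi>)"

definition homogeneous_harmonic :: "nat \<Rightarrow> ('a::euclidean_space \<Rightarrow> real) \<Rightarrow> bool" where
  "homogeneous_harmonic m p \<longleftrightarrow>
     real_polynomial_function p \<and>
     (\<forall>c x. p (c *\<^sub>R x) = c ^ m * p x) \<and>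
     (\<forall>x. laplacian p x = 0)"

text \<open>
  A function on the sphere is represented by its extension by \<open>0\<close> to the whole space, so
  that the spherical harmonics of degree \<open>m\<close> form a linear subspace of the space of all
  real-valued functions.
\<close>

definition spherical_harmonics :: "nat \<Rightarrow> ('a::euclidean_space \<Rightarrow> real) set" where
  "spherical_harmonics m =
     {(\<lambda>x. if x \<in> sphere 0 1 then p x else 0) | p. homogeneous_harmonic m p}"

definition fun_scale :: "real \<Rightarrow> ('a \<Rightarrow> real) \<Rightarrow> 'a \<Rightarrow> real" where
  "fun_scale c f = (\<lambda>x. c * f x)"

interpretation fun_space: vector_space "fun_scale :: real \<Rightarrow> ('a \<Rightarrow> real) \<Rightarrow> 'a \<Rightarrow> real"
  by unfold_locales (auto simp: fun_scale_def fun_eq_iff algebra_simps)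

definition orthonormal_harmonic_basis ::
  "nat \<Rightarrow> (nat \<Rightarrow> 'a::euclidean_space \<Rightarrow> real) \<Rightarrow> bool" where
  "orthonormal_harmonic_basis m Y \<longleftrightarrow>
     (let I = {1..fun_space.dim (spherical_harmonics m :: ('a \<Rightarrow> real) set)} in
        (\<forall>l\<in>I. Y l \<in> spherical_harmonics m) \<and>
        (\<forall>k\<in>I. \<forall>l\<in>I. sphere_inner (Y k) (Y l) = (if k = l then 1 else 0)) \<and>
        fun_space.span (Y ` I) = spherical_harmonics m)"

text \<open>
  The Jacobi polynomial. The last argument of \<open>fps_hypergeo\<close> scales the variable, so with
  value \<open>1\<close> evaluation of the series at \<open>z\<close> is the Gauss function
  \<open>2F1(-n, n + \<alpha> + \<beta> + 1; \<alpha> + 1; z)\<close>.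
\<close>

definition jacobi_poly :: "nat \<Rightarrow> real \<Rightarrow> real \<Rightarrow> real \<Rightarrow> real" where
  "jacobi_poly n \<alpha> \<beta> t =
     pochhammer (\<alpha> + 1) n / fact n *
     eval_fps (fps_hypergeo [- real n, real n + \<alpha> + \<beta> + 1] [\<alpha> + 1] 1) ((1 - t) / 2)"

text \<open>
  The function \<open>Q\<close> on the surface \<open>{(x, t). (norm x)\<^sup>2 = t \<and> 0 \<le> t \<and> t \<le> 1}\<close>, for a
  spherical harmonic \<open>Y\<close> of degree \<open>m\<close>. It is meant for \<open>t > 0\<close>: at the apex \<open>x / sqrt t\<close>
  is not a point of the sphere, and the formula does not give the limit when \<open>m = 0\<close>.
\<close>

definition surface_Q ::
  "real \<Rightarrow> real \<Rightarrow> nat \<Rightarrow> nat \<Rightarrow> ('a::euclidean_space \<Rightarrow> real) \<Rightarrow> 'a \<times> real \<Rightarrow> real" where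
  "surface_Q \<beta> \<gamma> n m Y = (\<lambda>(x, t).
     jacobi_poly (n - m) (\<beta> + real m + (real DIM('a) - 1) / 2) \<gamma> (1 - 2 * t) *
     t powr (real m / 2) * Y (x /\<^sub>R sqrt t))"

end

theory Submission
  imports Defs
begin

text \<open>
  Separation of variables. On the sphere a spherical harmonic is a homogeneous harmonic polynomial
  \<open>p\<close> of degree \<open>m\<close>, whose extension of degree \<open>0\<close> is \<open>p x / norm x ^ m\<close>; Euler's identity
  gives the eigenvalue \<open>- m (m + d - 2)\<close>. In the variable \<open>t\<close> the Jacobi polynomial is the
  terminating hypergeometric series \<open>2F1(-k, k + \<alpha> + \<gamma> + 1; \<alpha> + 1; t)\<close> with \<open>k = n - m\<close> and
  \<open>\<alpha> = m + d/2 - 1\<close>, and conjugating Gauss's equation with \<open>t powr (m / 2)\<close> gives the claim: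
  the terms in \<open>1 / t\<close> cancel precisely against the spherical eigenvalue.
\<close>

section \<open>The spherical Laplacian of a spherical harmonic\<close>

text \<open>Induction on the construction of polynomials. Since the derivative is again a
  polynomial, the lemma can be applied twice, as second partial derivatives require.\<close>

lemma real_polynomial_function_directional_derivative:
  fixes p :: "'a::euclidean_space \<Rightarrow> real"
  assumes "real_polynomial_function p"
  shows "\<exists>q. real_polynomial_function q \<and>
    (\<forall>x s. ((\<lambda>s. p (x + s *\<^sub>R b)) has_real_derivative q (x + s *\<^sub>R b)) (at s))"
  using assms
proof (induction rule: real_polynomial_function.induct)
  case (linear f)
  interpret bounded_linear f by (fact linear)
  have "((\<lambda>s. f (x + s *\<^sub>R b)) has_real_derivative f b) (at s)" for x s
    unfolding add scaleR by (auto intro!: derivative_eq_intros)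
  then show ?case
    by (intro exI[of _ "\<lambda>_. f b"]) (auto intro: real_polynomial_function.intros)
next
  case (const c)
  then show ?case
    by (intro exI[of _ "\<lambda>_. 0"]) (auto intro: real_polynomial_function.intros)
next
  case (add f g)
  then obtain f' g' where "real_polynomial_function f'" "real_polynomial_function g'"
    and "\<And>x s. ((\<lambda>s. f (x + s *\<^sub>R b)) has_real_derivative f' (x + s *\<^sub>R b)) (at s)"
    and "\<And>x s. ((\<lambda>s. g (x + s *\<^sub>R b)) has_real_derivative g' (x + s *\<^sub>R b)) (at s)"
    by blast
  then show ?case
    by (intro exI[of _ "\<lambda>x. f' x + g' x"])
      (auto intro: real_polynomial_function.intros DERIV_add)
next
  case (mult f g)
  then obtain f' g' where "real_polynomial_function f'" "real_polynomial_function g'"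
    and "\<And>x s. ((\<lambda>s. f (x + s *\<^sub>R b)) has_real_derivative f' (x + s *\<^sub>R b)) (at s)"
    and "\<And>x s. ((\<lambda>s. g (x + s *\<^sub>R b)) has_real_derivative g' (x + s *\<^sub>R b)) (at s)"
    by blast
  with mult.hyps show ?case
    by (intro exI[of _ "\<lambda>x. f' x * g x + g' x * f x"])
      (auto intro: real_polynomial_function.intros DERIV_mult)
qed

text \<open>Differentiate \<open>p ((1 + s) *\<^sub>R x) = (1 + s) ^ m * p x\<close> at
  \<open>s = 0\<close>. Full differentiability makes the directional derivative linear in the
  direction, so the derivative along \<open>x\<close> splits over \<open>Basis\<close>.\<close>

lemma euler_homogeneous:
  fixes p :: "'a::euclidean_space \<Rightarrow> real"
  assumes p: "p differentiable (at x)"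
    and hom: "\<And>c. p (c *\<^sub>R x) = c ^ m * p x"
    and q: "\<And>b. b \<in> Basis \<Longrightarrow> ((\<lambda>s. p (x + s *\<^sub>R b)) has_real_derivative q b) (at 0)"
  shows "(\<Sum>b\<in>Basis. (x \<bullet> b) * q b) = real m * p x"
proof -
  obtain D where D: "(p has_derivative D) (at x)"
    using p by (auto simp: differentiable_def)
  interpret D: bounded_linear D
    using D by (rule has_derivative_bounded_linear)
  have line: "((\<lambda>s. p (x + s *\<^sub>R v)) has_real_derivative D v) (at 0)" for v
  proof -
    have "((\<lambda>s. x + s *\<^sub>R v) has_derivative (\<lambda>s. s *\<^sub>R v)) (at 0)"
      by (auto intro!: derivative_eq_intros)
    moreover have "(p has_derivative D) (at (x + 0 *\<^sub>R v))"
      using D by simp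
    ultimately have "((\<lambda>s. p (x + s *\<^sub>R v)) has_derivative (\<lambda>s. D (s *\<^sub>R v))) (at 0)"
      by (rule has_derivative_compose)
    then show ?thesis
      by (simp add: has_field_derivative_def D.scaleR mult_commute_abs)
  qed
  have "(\<lambda>s. p (x + s *\<^sub>R x)) = (\<lambda>s. (1 + s) ^ m * p x)"
    by (simp flip: hom add: scaleR_add_left)
  moreover have "((\<lambda>s. (1 + s) ^ m * p x) has_real_derivative real m * p x) (at 0)"
    by (auto intro!: derivative_eq_intros)
  ultimately have "D x = real m * p x"
    using line[of x] by (metis DERIV_unique)
  moreover have "D x = (\<Sum>b\<in>Basis. (x \<bullet> b) * D b)"
    by (subst euclidean_representation[of x, symmetric]) (simp only: D.sum D.scaleR real_scaleR_def)
  moreover have "D b = q b" if "b \<in> Basis" for b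
    using DERIV_unique[OF line q] that by blast
  ultimately show ?thesis
    by simp
qed

lemma inner_self_powr_derivative:
  fixes x b :: "'a::real_inner"
  assumes "x + s *\<^sub>R b \<noteq> 0"
  shows "((\<lambda>s. ((x + s *\<^sub>R b) \<bullet> (x + s *\<^sub>R b)) powr a) has_real_derivative
    2 * a * ((x + s *\<^sub>R b) \<bullet> (x + s *\<^sub>R b)) powr (a - 1) * ((x + s *\<^sub>R b) \<bullet> b)) (at s)"
proof -
  have "((\<lambda>s. (x + s *\<^sub>R b) \<bullet> (x + s *\<^sub>R b)) has_real_derivative 2 * ((x + s *\<^sub>R b) \<bullet> b)) (at s)"
    unfolding has_field_derivative_def
    by (rule has_derivative_eq_rhs, (rule derivative_intros)+) (auto simp: fun_eq_iff inner_commute)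
  then show ?thesis
    using assms by (auto intro!: derivative_eq_intros)
qed

lemma partial_deriv_eqI:
  assumes "((\<lambda>s. f (x + s *\<^sub>R b)) has_real_derivative D) (at 0)"
  shows "partial_deriv b f x = D"
  unfolding partial_deriv_def using assms by (rule DERIV_imp_deriv)

lemma eventually_line_in_open:
  fixes x :: "'a::real_normed_vector"
  assumes "open S" "x \<in> S"
  shows "\<forall>\<^sub>F s in nhds 0. x + s *\<^sub>R b \<in> S"
proof -
  have "((\<lambda>s. x + s *\<^sub>R b) \<longlongrightarrow> x + 0 *\<^sub>R b) (nhds 0)"
    by (intro tendsto_intros filterlim_ident)
  then show ?thesis
    using assms by (auto dest: topological_tendstoD)
qed

text \<open>Derivatives depend only on values near \<open>x\<close>, so a formula for the first one
  on an open set suffices. This covers functions that are singular at the origin.\<close>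

lemma second_partial_deriv_eqI:
  assumes "open S" "x \<in> S"
    and "\<And>y. y \<in> S \<Longrightarrow> ((\<lambda>s. f (y + s *\<^sub>R b)) has_real_derivative f' y) (at 0)"
    and "((\<lambda>s. f' (x + s *\<^sub>R b)) has_real_derivative D) (at 0)"
  shows "partial_deriv b (partial_deriv b f) x = D"
proof (rule partial_deriv_eqI)
  have "\<forall>\<^sub>F s in nhds 0. x + s *\<^sub>R b \<in> S"
    using assms(1,2) by (rule eventually_line_in_open)
  then have "\<forall>\<^sub>F s in nhds 0. partial_deriv b f (x + s *\<^sub>R b) = f' (x + s *\<^sub>R b)"
    by eventually_elim (rule partial_deriv_eqI, rule assms(3))
  then show "((\<lambda>s. partial_deriv b f (x + s *\<^sub>R b)) has_real_derivative D) (at 0)"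
    using assms(4) by (subst DERIV_cong_ev) auto
qed

text \<open>The factor is a power of \<open>x \<bullet> x\<close> because such powers are closed
  under differentiation along a line, up to linear factors and a lowered exponent.\<close>

lemma homogeneous_normalize:
  fixes x :: "'a::euclidean_space"
  assumes "homogeneous_harmonic m p" "x \<noteq> 0"
  shows "p (x /\<^sub>R norm x) = p x * (x \<bullet> x) powr (- real m / 2)"
proof -
  have "(x \<bullet> x) powr (- real m / 2) = norm x powr (2 * (- real m / 2))"
    unfolding dot_square_norm by (simp add: powr_powr flip: powr_numeral)
  also have "\<dots> = inverse (norm x) ^ m"
    using assms(2) by (simp add: powr_minus powr_realpow power_inverse)
  finally show ?thesis
    using assms(1) by (simp add: homogeneous_harmonic_def mult.commute)
qed

text \<open>The constant \<open>c\<close> later absorbs the radial factor, which is fixed while the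
  operator acts on the spherical variable.\<close>

lemma laplace_beltrami_spherical_harmonic:
  fixes Y :: "'a::euclidean_space \<Rightarrow> real"
  assumes Y: "Y \<in> spherical_harmonics m" and \<xi>: "\<xi> \<in> sphere 0 1"
  shows "laplace_beltrami (\<lambda>x. c * Y x) \<xi> = - (real m * (real m + real DIM('a) - 2)) * (c * Y \<xi>)"
proof -
  obtain p where Yp: "Y = (\<lambda>x. if x \<in> sphere 0 1 then p x else 0)"
    and hh: "homogeneous_harmonic m p"
    using Y by (auto simp: spherical_harmonics_def)
  have poly: "real_polynomial_function p" and hom: "\<And>c x. p (c *\<^sub>R x) = c ^ m * p x"
    and harm: "laplacian p \<xi> = 0"
    using hh by (auto simp: homogeneous_harmonic_def)
  obtain q where q: "\<And>b. real_polynomial_function (q b)"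
    "\<And>b x s. ((\<lambda>s. p (x + s *\<^sub>R b)) has_real_derivative q b (x + s *\<^sub>R b)) (at s)"
    using real_polynomial_function_directional_derivative[OF poly] by metis
  obtain r where r: "\<And>b x s. ((\<lambda>s. q b (x + s *\<^sub>R b)) has_real_derivative r b (x + s *\<^sub>R b)) (at s)"
  proof -
    have "\<exists>r. \<forall>x s. ((\<lambda>s. q b (x + s *\<^sub>R b)) has_real_derivative r (x + s *\<^sub>R b)) (at s)" for b
      using real_polynomial_function_directional_derivative[OF q(1)] by blast
    then show ?thesis
      using that by metis
  qed
  define G where "G = (\<lambda>x. c * Y (x /\<^sub>R norm x))"
  define u where "u a x = (x \<bullet> x) powr a" for a and x :: 'a
  define a where "a = - real m / 2"
  have u: "((\<lambda>s. u a (x + s *\<^sub>R b)) has_real_derivative 2 * a * u (a - 1) x * (x \<bullet> b)) (at 0)"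
    if "x \<noteq> 0" for a b and x :: 'a
    using inner_self_powr_derivative[of x 0 b a] that by (simp add: u_def)
  have G: "G x = c * (p x * u a x)" if "x \<noteq> 0" for x
    using homogeneous_normalize[OF hh that] that by (simp add: G_def Yp u_def a_def)
  have dG: "((\<lambda>s. G (x + s *\<^sub>R b)) has_real_derivative
      c * (q b x * u a x + 2 * a * (p x * u (a - 1) x * (x \<bullet> b)))) (at 0)"
    if "x \<noteq> 0" for x b
  proof -
    have "\<forall>\<^sub>F s in nhds 0. x + s *\<^sub>R b \<in> - {0}"
      using that by (intro eventually_line_in_open) auto
    then have ev: "\<forall>\<^sub>F s in nhds 0. G (x + s *\<^sub>R b) = c * (p (x + s *\<^sub>R b) * u a (x + s *\<^sub>R b))"
      by eventually_elim (simp add: G)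
    have "((\<lambda>s. c * (p (x + s *\<^sub>R b) * u a (x + s *\<^sub>R b))) has_real_derivative
        c * (q b x * u a x + 2 * a * (p x * u (a - 1) x * (x \<bullet> b)))) (at 0)"
      by (rule DERIV_cong[OF DERIV_cmult[OF DERIV_mult[OF q(2) u[OF that]]]]) (simp add: algebra_simps)
    with ev show ?thesis
      by (subst DERIV_cong_ev) auto
  qed
  have \<xi>0: "\<xi> \<noteq> 0" and \<xi>1: "\<xi> \<bullet> \<xi> = 1"
    using \<xi> by (auto simp: dot_square_norm)
  \<comment> \<open>On the sphere the powers disappear, and the exponents survive only as
    coefficients.\<close>
  have u1: "u a \<xi> = 1" for a
    by (simp add: u_def \<xi>1)
  have ddG: "partial_deriv b (partial_deriv b G) \<xi> =
      c * (r b \<xi> + 4 * a * ((\<xi> \<bullet> b) * q b \<xi>) + 2 * a * p \<xi> + 4 * a * (a - 1) * p \<xi> * (\<xi> \<bullet> b)\<^sup>2)"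
    if "b \<in> Basis" for b
  proof (rule second_partial_deriv_eqI[where S = "- {0}"])
    show "((\<lambda>s. c * (q b (\<xi> + s *\<^sub>R b) * u a (\<xi> + s *\<^sub>R b) +
        2 * a * (p (\<xi> + s *\<^sub>R b) * u (a - 1) (\<xi> + s *\<^sub>R b) * ((\<xi> + s *\<^sub>R b) \<bullet> b)))) has_real_derivative
      c * (r b \<xi> + 4 * a * ((\<xi> \<bullet> b) * q b \<xi>) + 2 * a * p \<xi> + 4 * a * (a - 1) * p \<xi> * (\<xi> \<bullet> b)\<^sup>2)) (at 0)"
    proof -
      have "((\<lambda>s. (\<xi> + s *\<^sub>R b) \<bullet> b) has_real_derivative 1) (at 0)"
        using that by (auto simp: inner_add_left intro!: derivative_eq_intros)
      then show ?thesis
        by (intro DERIV_cong[OF DERIV_cmult[OF DERIV_add[OF DERIV_mult[OF r u[OF \<xi>0]]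
            DERIV_cmult[OF DERIV_mult[OF DERIV_mult[OF q(2) u[OF \<xi>0]]]]]]])
          (auto simp: u1 algebra_simps power2_eq_square)
    qed
  qed (use \<xi>0 dG in auto)
  have "partial_deriv b (partial_deriv b p) \<xi> = r b \<xi>" for b
    using q(2)[where s = 0] r[where s = 0]
    by (intro second_partial_deriv_eqI[where S = UNIV]) auto
  then have lap: "(\<Sum>b\<in>Basis. r b \<xi>) = 0"
    using harm by (simp add: laplacian_def)
  have euler: "(\<Sum>b\<in>Basis. (\<xi> \<bullet> b) * q b \<xi>) = real m * p \<xi>"
  proof (rule euler_homogeneous)
    show "p differentiable (at \<xi>)"
      using poly by (simp add: differentiable_at_polynomial_function real_polynomial_function_eq)
  qed (use hom q(2)[of \<xi> _ 0] in auto)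
  have sq: "(\<Sum>b\<in>Basis. (\<xi> \<bullet> b)\<^sup>2) = 1"
    using \<xi>1 by (simp add: euclidean_inner[of \<xi> \<xi>] power2_eq_square)
  \<comment> \<open>The four sums are harmonicity, Euler's identity, the dimension and the squared
    norm. With \<open>a = - m / 2\<close> they add up to
    \<open>4 * a * m + 2 * a * d + 4 * a * (a - 1) = - m * (m + d - 2)\<close>, where d is the
    dimension.\<close>
  have "laplacian G \<xi> = c * ((\<Sum>b\<in>Basis. r b \<xi>) + 4 * a * (\<Sum>b\<in>Basis. (\<xi> \<bullet> b) * q b \<xi>) +
      DIM('a) * (2 * a * p \<xi>) + 4 * a * (a - 1) * p \<xi> * (\<Sum>b\<in>Basis. (\<xi> \<bullet> b)\<^sup>2))"
    by (simp add: laplacian_def ddG sum.distrib flip: sum_distrib_left)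
  also have "\<dots> = - (real m * (real m + real DIM('a) - 2)) * (c * p \<xi>)"
    unfolding lap euler sq by (simp add: a_def field_simps)
  finally show ?thesis
    using \<xi> by (simp add: laplace_beltrami_def G_def Yp)
qed

section \<open>Gauss's equation for the Jacobi polynomials\<close>

definition hypergeo_poly :: "nat \<Rightarrow> real \<Rightarrow> real \<Rightarrow> real poly" where
  "hypergeo_poly k b c =
     (\<Sum>i\<le>k. monom (pochhammer (- real k) i * pochhammer b i / (pochhammer c i * fact i)) i)"

text \<open>No bound on \<open>i\<close> is needed: \<open>pochhammer (- real k) i\<close> vanishes
  for \<open>i > k\<close>.\<close>

lemma coeff_hypergeo_poly:
  "coeff (hypergeo_poly k b c) i =
     pochhammer (- real k) i * pochhammer b i / (pochhammer c i * fact i)"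
proof (cases "i \<le> k")
  case True
  then show ?thesis
    by (simp add: hypergeo_poly_def coeff_sum)
next
  case False
  then show ?thesis
    by (simp add: hypergeo_poly_def coeff_sum pochhammer_of_nat_eq_0_iff)
qed

text \<open>The series is a polynomial coefficientwise, so no question of convergence
  arises.\<close>

lemma eval_fps_hypergeo_terminating:
  "eval_fps (fps_hypergeo [- real k, b] [c] 1) z = poly (hypergeo_poly k b c) z"
proof -
  have "fps_hypergeo [- real k, b] [c] 1 = fps_of_poly (hypergeo_poly k b c)"
    by (simp add: fps_eq_iff coeff_hypergeo_poly)
  then show ?thesis
    by simp
qed

text \<open>Compare coefficients: that of degree \<open>i\<close> on the left is
  \<open>(i + 1) * (i + c) * p_(i+1) - (i - k) * (i + b) * p_i\<close>, where \<open>p_i\<close> are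
  the coefficients of the polynomial. This is zero by the ratio of consecutive hypergeometric
  coefficients; \<open>c > 0\<close> keeps the denominators nonzero.\<close>

lemma hypergeo_poly_ode:
  assumes "c > 0"
  shows "x * (1 - x) * poly (pderiv (pderiv (hypergeo_poly k b c))) x
    + (c - (b - real k + 1) * x) * poly (pderiv (hypergeo_poly k b c)) x
    + real k * b * poly (hypergeo_poly k b c) x = 0"
proof -
  define p where "p = hypergeo_poly k b c"
  have rec: "(1 + real i) * (real i + c) * coeff p (Suc i) = (real i - real k) * (real i + b) * coeff p i" for i
  proof -
    have "pochhammer c i \<noteq> 0" "real i + c \<noteq> 0"
      using assms by (auto simp: pochhammer_eq_0_iff)
    then have "coeff p (Suc i) = (real i - real k) * (real i + b) * coeff p i / ((1 + real i) * (real i + c))"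
      by (simp add: p_def coeff_hypergeo_poly pochhammer_Suc ac_simps)
    with \<open>real i + c \<noteq> 0\<close> show ?thesis
      by simp
  qed
  have "[:0, 1, -1:] * pderiv (pderiv p) + [:c, - (b - real k + 1):] * pderiv p + [:real k * b:] * p = 0"
  proof (rule poly_eqI)
    fix i
    show "coeff ([:0, 1, -1:] * pderiv (pderiv p) + [:c, - (b - real k + 1):] * pderiv p
        + [:real k * b:] * p) i = coeff 0 i"
    \<comment> \<open>Multiplication by \<open>x * (1 - x)\<close> shifts coefficients by up to two
      places, hence the separate cases 0, 1 and at least 2.\<close>
    proof (cases i)
      case 0
      then show ?thesis
        using rec[of 0] by (simp add: coeff_pderiv algebra_simps)
    next
      case (Suc j)
      show ?thesis
      proof (cases j)
        case 0
        then show ?thesis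
          using Suc rec[of 1] by (simp add: coeff_pderiv coeff_pCons algebra_simps)
      next
        case (Suc l)
        then show ?thesis
          using \<open>i = Suc j\<close> rec[of i] by (simp add: coeff_pderiv coeff_pCons algebra_simps)
      qed
    qed
  qed
  from arg_cong[OF this, of "\<lambda>p. poly p x"] show ?thesis
    by (simp add: p_def algebra_simps)
qed

section \<open>The differential equation\<close>

lemma second_deriv_eqI:
  fixes f :: "real \<Rightarrow> real"
  assumes "open S" "t \<in> S"
    and "\<And>s. s \<in> S \<Longrightarrow> (f has_real_derivative f' s) (at s)"
    and "(f' has_real_derivative D) (at t)"
  shows "(deriv ^^ 2) f t = D"
proof -
  have "\<forall>\<^sub>F s in nhds t. s \<in> S"
    using assms(1,2) by (rule eventually_nhds_in_open)
  then have "\<forall>\<^sub>F s in nhds t. deriv f s = f' s"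
    by eventually_elim (rule DERIV_imp_deriv, rule assms(3))
  then have "deriv (deriv f) t = deriv f' t"
    by (rule deriv_cong_ev) simp
  then show ?thesis
    using DERIV_imp_deriv[OF assms(4)] by (simp add: numeral_2_eq_2)
qed

theorem proposition3p2:
  fixes \<beta> \<gamma> d :: real and n m l :: nat
    and Y :: "nat \<Rightarrow> 'a::euclidean_space \<Rightarrow> real"
    and y :: "real \<Rightarrow> 'a \<Rightarrow> real"
    and t :: real and \<xi> :: 'a
  assumes "DIM('a) \<ge> 2"
    and "d = real DIM('a)"
    and "\<beta> = - 1 / 2"
    and "\<gamma> > - 1"
    and "m \<le> n"
    and "orthonormal_harmonic_basis m Y"
    and "1 \<le> l" and "l \<le> fun_space.dim (spherical_harmonics m :: ('a \<Rightarrow> real) set)"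
    and "y = (\<lambda>t \<xi>. surface_Q \<beta> \<gamma> n m (Y l) (sqrt t *\<^sub>R \<xi>, t))"
    and "0 < t" and "t < 1" and "\<xi> \<in> sphere 0 1"
  shows "t * (1 - t) * (deriv ^^ 2) (\<lambda>s. y s \<xi>) t
       + (d / 2 - (\<gamma> + d / 2 + 1) * t) * deriv (\<lambda>s. y s \<xi>) t
       + (1 - t) / (4 * t) * laplace_beltrami (y t) \<xi>
       = - (real n * (real n + \<gamma> + d / 2) - real m * (real n + (\<gamma> + d - 1) / 2)) * y t \<xi>"
proof -
  define k where "k = n - m"
  define \<alpha> where "\<alpha> = real m + d / 2 - 1"
  define P where "P = hypergeo_poly k (real k + \<alpha> + \<gamma> + 1) (\<alpha> + 1)"
  define F where "F = poly P"
  define F1 where "F1 = poly (pderiv P)"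
  define F2 where "F2 = poly (pderiv (pderiv P))"
  define K where "K = pochhammer (\<alpha> + 1) k / fact k"
  define a where "a = real m / 2"
  have Y: "Y l \<in> spherical_harmonics m"
    using assms by (auto simp: orthonormal_harmonic_basis_def Let_def)
  \<comment> \<open>The value \<open>\<beta> = - 1 / 2\<close> enters here.\<close>
  have \<alpha>: "\<beta> + real m + (real DIM('a) - 1) / 2 = \<alpha>"
    using assms(2,3) by (simp add: \<alpha>_def field_simps)
  \<comment> \<open>The Jacobi argument \<open>1 - 2 * s\<close> becomes the hypergeometric argument
    \<open>s\<close>, and positivity of \<open>s\<close> cancels \<open>sqrt s\<close> inside
    \<open>Y l\<close>.\<close>
  have y: "y s \<eta> = K * F s * s powr a * Y l \<eta>" if "s > 0" for s \<eta>
    using that unfolding assms(9) surface_Q_def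
    by (simp add: \<alpha> jacobi_poly_def eval_fps_hypergeo_terminating F_def P_def K_def a_def k_def)
  have dF: "(F has_real_derivative F1 s) (at s)" "(F1 has_real_derivative F2 s) (at s)" for s
    by (simp_all add: F_def F1_def F2_def poly_DERIV)
  define C where "C = K * Y l \<xi>"
  define y1 where "y1 s = C * (F1 s * s powr a + a * F s * s powr (a - 1))" for s
  define y2 where "y2 = C * (F2 t * t powr a + 2 * a * F1 t * t powr (a - 1)
    + a * (a - 1) * F t * t powr (a - 2))"
  have dy: "((\<lambda>s. y s \<xi>) has_real_derivative y1 s) (at s)" if "s \<in> {0<..}" for s
  proof -
    have "((\<lambda>s. K * F s * s powr a * Y l \<xi>) has_real_derivative y1 s) (at s)"
      using that dF(1)[of s]
      by (auto intro!: derivative_eq_intros simp: y1_def C_def) (simp add: algebra_simps)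
    moreover have "\<forall>\<^sub>F s in nhds s. s \<in> {0<..}"
      using that by (intro eventually_nhds_in_open) auto
    then have "\<forall>\<^sub>F s in nhds s. y s \<xi> = K * F s * s powr a * Y l \<xi>"
      by eventually_elim (simp add: y)
    ultimately show ?thesis
      by (subst DERIV_cong_ev) auto
  qed
  have ddy: "(y1 has_real_derivative y2) (at t)"
    unfolding y1_def using \<open>t > 0\<close> dF[of t]
    by (auto intro!: derivative_eq_intros simp: y2_def algebra_simps)
  have deriv2: "(deriv ^^ 2) (\<lambda>s. y s \<xi>) t = y2"
    using \<open>t > 0\<close> dy ddy by (intro second_deriv_eqI[where S = "{0<..}"]) auto
  have deriv1: "deriv (\<lambda>s. y s \<xi>) t = y1 t"
    using \<open>t > 0\<close> dy by (intro DERIV_imp_deriv) auto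
  have lb: "laplace_beltrami (y t) \<xi> = - (real m * (real m + d - 2)) * y t \<xi>"
  proof -
    have "y t = (\<lambda>x. (K * F t * t powr a) * Y l x)"
      using \<open>t > 0\<close> by (simp add: y fun_eq_iff)
    then show ?thesis
      using laplace_beltrami_spherical_harmonic[OF Y assms(12)] assms(2) by simp
  qed
  \<comment> \<open>The lower parameter \<open>\<alpha> + 1 = m + d / 2\<close> is positive.\<close>
  have gauss: "t * (1 - t) * F2 t + (\<alpha> + 1 - (\<alpha> + \<gamma> + 2) * t) * F1 t
      + real k * (real k + \<alpha> + \<gamma> + 1) * F t = 0"
    using hypergeo_poly_ode[of "\<alpha> + 1" t k "real k + \<alpha> + \<gamma> + 1"] assms(1,2)
    by (simp add: F_def F1_def F2_def P_def \<alpha>_def algebra_simps)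
  have k: "real k = real n - real m"
    using assms(5) by (simp add: k_def)
  \<comment> \<open>With all powers written as \<open>T\<close> over integer powers of
    \<open>t\<close>, the remaining identity is rational in \<open>t\<close>.\<close>
  define T where "T = t powr a"
  have yt: "y t \<xi> = C * F t * T"
    using \<open>t > 0\<close> by (simp add: y C_def T_def)
  have y1t: "y1 t = C * (F1 t * T + a * F t * (T / t))"
    using \<open>t > 0\<close> by (simp add: y1_def T_def powr_diff)
  have y2: "y2 = C * (F2 t * T + 2 * a * F1 t * (T / t) + a * (a - 1) * F t * (T / t\<^sup>2))"
    using \<open>t > 0\<close> by (simp add: y2_def T_def powr_diff)
  \<comment> \<open>The terms in \<open>1 / t\<close> cancel since
    \<open>a * (a - 1) + a * d / 2 = m * (m + d - 2) / 4\<close>. The cross term of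
    \<open>y2\<close> turns \<open>d / 2\<close> into \<open>\<alpha> + 1\<close>, and the constants
    combine to \<open>(n - m) * (n + \<gamma> + d / 2)\<close>, which is
    \<open>k * (k + \<alpha> + \<gamma> + 1)\<close>.\<close>
  have "t * (1 - t) * y2 + (d / 2 - (\<gamma> + d / 2 + 1) * t) * y1 t
      + (1 - t) / (4 * t) * (- (real m * (real m + d - 2)) * y t \<xi>)
      + (real n * (real n + \<gamma> + d / 2) - real m * (real n + (\<gamma> + d - 1) / 2)) * y t \<xi>
    = C * T * (t * (1 - t) * F2 t + (\<alpha> + 1 - (\<alpha> + \<gamma> + 2) * t) * F1 t
      + real k * (real k + \<alpha> + \<gamma> + 1) * F t)"
    using \<open>t > 0\<close> unfolding yt y1t y2 k \<alpha>_def a_def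
    by (simp add: field_simps power2_eq_square)
  also have "\<dots> = 0"
    by (simp add: gauss)
  finally show ?thesis
    unfolding deriv2 deriv1 lb by linarith
qed

end
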